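(* Let $p$ be a prepoint, $X$ an internal predicate, $i\in\mathbb Z$, $a\in\mathbb A_i$ and $x\in\mathcal L_i$. Then $p\models X[a\mapsto x]$ if and only if $p[x\cdot a]\models X$.
   Context: Atoms: for each $i\in\mathbb Z$ a set $\mathbb A_i$ of atoms (pairwise disjoint, each of cardinality $\beth_\omega$, in Fraenkel–Mostowski set theory); $\mathrm{level}(a)=i$ iff $a\in\mathbb A_i$. A set of atoms is small if its cardinality is $<\beth_\omega$; $\mathsf N a'\in\mathbb A_i.\Phi(a')$ means $\{a'\in\mathbb A_i:\Phi(a')\}$ has small complement in $\mathbb A_i$. $(a\,b)$ is the swapping of two atoms of equal level. Distinct letters $a,b,\dots$ denote distinct atoms. Internal syntax (binders $[a]$ up to $\alpha$-equivalence): internal predicates $\wedge(\mathcal X)$ ($\mathcal X$ a finite set of internal predicates), $\neg X$, $\forall[a]X$, $\in(x,a)$ with $a\in\mathbb A_{i+1}$, $x\in\mathcal L_i$; internal sets of level $i$: $\mathrm{atm}(a)$ ($a\in\mathbb A_i$) and $[a]X$ ($a\in\mathbb A_{i-1}$). $a\#Z$ means $a$ not free in $Z$. Substitution $Z[a\mapsto x]$ ($a\in\mathbb A_i$, $x\in\mathcal L_i$): $\wedge(\mathcal X)[a\mapsto x]=\wedge\{X[a\mapsto x]\}$; $(\neg X)[a\mapsto x]=\neg(X[a\mapsto x])$; $(\forall[b]X)[a\mapsto x]=\forall[b](X[a\mapsto x])$ for $b\#x$; $\in(y,a)[a\mapsto\mathrm{atm}(n)]=\in(y[a\mapsto\mathrm{atm}(n)],n)$;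 $\in(y,a)[a\mapsto[a']X]=X[a'\mapsto y[a\mapsto[a']X]]$ ($a'$ fresh); $\in(y,b)[a\mapsto x]=\in(y[a\mapsto x],b)$; $\mathrm{atm}(a)[a\mapsto x]=x$; $\mathrm{atm}(b)[a\mapsto x]=\mathrm{atm}(b)$; $([c]X)[a\mapsto x]=[c](X[a\mapsto x])$ for $c\#x$ (well defined). A prepoint is a subset $p$ of $\bigcup_i\mathbb A_i\times\mathcal L_{i-1}$, elements written $a\triangleright y$. Validity: $p\models\wedge(\mathcal X)$ iff $p\models X$ for all $X\in\mathcal X$; $p\models\neg X$ iff not $p\models X$; $p\models\forall[a]X$ iff $\mathsf N a'\in\mathbb A_{\mathrm{level}(a)}.\,p\models(a'\,a)\cdot X$; $p\models\in(y,a)$ iff $a\triangleright y\in p$. The prepoint $p[x\cdot a]$ (for $a\in\mathbb A_i$, $x\in\mathcal L_i$) is defined by: for $b\neq a$, $b\in\mathbb A_j$, $y\in\mathcal L_{j-1}$: $b\triangleright y\in p[x\cdot a]$ iff $b\triangleright(y[a\mapsto x])\in p$; for $y\in\mathcal L_{i-1}$: if $x=[a']X$ (with $a'$ fresh) then $a\triangleright y\in p[x\cdot a]$ iff $p\models X[a'\mapsto y[a\mapsto x]]$, and if $x=\mathrm{atm}(n)$ ($n\in\mathbb A_i$, possibly $n=a$) then $a\triangleright y\in p[x\cdot a]$ iff $n\triangleright(y[a\mapsto\mathrm{atm}(n)])\in p$. *)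

theory Defs
  imports "HOL-Library.FSet" "HOL-Library.Equipollence" "HOL-Combinatorics.Transposition"
begin

section \<open>Atoms\<close>

text \<open>
  A set \<open>A\<close> has cardinality \<open>\<beth>\<^sub>\<omega>\<close>, the supremum of the cardinals \<open>\<beth>\<^sub>n\<close>, if it is the union of a
  sequence of sets \<open>B n\<close> of cardinality \<open>\<beth>\<^sub>n\<close>. (A countable union of such sets has at most
  \<open>\<aleph>\<^sub>0 \<cdot> \<beth>\<^sub>\<omega> = \<beth>\<^sub>\<omega>\<close> elements, and conversely every set of cardinality \<open>\<beth>\<^sub>\<omega>\<close> can be so written.)
\<close>

definition beth_omega_card :: "'b set \<Rightarrow> bool" where
  "beth_omega_card A \<longleftrightarrow>
     (\<exists>B. B 0 \<approx> (UNIV :: nat set) \<and> (\<forall>n. B (Suc n) \<approx> Pow (B n)) \<and> A = (\<Union>n. B n))"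

text \<open>
  A type of class \<open>atom\<close> is the union of all sets of atoms; as \<open>level\<close> is a function, the sets
  of atoms of different levels are disjoint.
\<close>

class atom =
  fixes level :: "'a \<Rightarrow> int"
  assumes beth_omega_card_level: "beth_omega_card {a. level a = i}"

definition \<A> :: "int \<Rightarrow> 'a::atom set" where
  "\<A> i = {a. level a = i}"

text \<open>
  Small means of cardinality less than \<open>\<beth>\<^sub>\<omega>\<close>. As every \<^term>\<open>\<A> i\<close> has cardinality \<open>\<beth>\<^sub>\<omega>\<close>, it does not
  matter which of them is used for the comparison.
\<close>

definition small :: "'a::atom set \<Rightarrow> bool" where
  "small S \<longleftrightarrow> S \<prec> (\<A> 0 :: 'a set)"

text \<open>\<open>New i \<Phi>\<close> is the quantifier ``for all but a small set of \<open>a'\<close> of level \<open>i\<close>, \<open>\<Phi> a'\<close>''.\<close>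

definition New :: "int \<Rightarrow> ('a::atom \<Rightarrow> bool) \<Rightarrow> bool" where
  "New i \<Phi> \<longleftrightarrow> small (\<A> i - {a \<in> \<A> i. \<Phi> a})"

text \<open>Only swappings of atoms of equal level are considered; the value in the other case is a dummy.\<close>

definition swap_atom :: "'a::atom \<Rightarrow> 'a \<Rightarrow> 'a \<Rightarrow> 'a" where
  "swap_atom a b = (if level a = level b then transpose a b else id)"

section \<open>Internal syntax\<close>

text \<open>
  One type contains the raw internal predicates and the raw internal sets (the last two
  constructors); the predicates \<open>is_pred\<close> and \<open>is_set\<close> below pick out the well-formed ones.
  Here \<open>RAll a X\<close> and \<open>RComp a X\<close> bind \<open>a\<close> in \<open>X\<close>.
\<close>

datatype 'a raw =
    RConj "'a raw fset"
  | RNeg "'a raw"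
  | RAll 'a "'a raw"
  | RElem "'a raw" 'a
  | RAtm 'a
  | RComp 'a "'a raw"

primrec rfree :: "'a raw \<Rightarrow> 'a set" where
  "rfree (RConj F) = \<Union> (fset (rfree |`| F))"
| "rfree (RNeg X) = rfree X"
| "rfree (RAll a X) = rfree X - {a}"
| "rfree (RElem x a) = insert a (rfree x)"
| "rfree (RAtm a) = {a}"
| "rfree (RComp a X) = rfree X - {a}"

text \<open>
  The least congruence that contains the renaming of bound atoms to atoms of the same level.
\<close>

inductive alpha :: "'a::atom raw \<Rightarrow> 'a raw \<Rightarrow> bool" (infix "\<approx>\<^sub>\<alpha>" 50) where
  refl: "X \<approx>\<^sub>\<alpha> X"
| sym: "X \<approx>\<^sub>\<alpha> Y \<Longrightarrow> Y \<approx>\<^sub>\<alpha> X"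
| trans: "X \<approx>\<^sub>\<alpha> Y \<Longrightarrow> Y \<approx>\<^sub>\<alpha> Z \<Longrightarrow> X \<approx>\<^sub>\<alpha> Z"
| Conj: "(\<And>X. X |\<in>| F \<Longrightarrow> \<exists>Y. Y |\<in>| G \<and> X \<approx>\<^sub>\<alpha> Y) \<Longrightarrow>
         (\<And>Y. Y |\<in>| G \<Longrightarrow> \<exists>X. X |\<in>| F \<and> X \<approx>\<^sub>\<alpha> Y) \<Longrightarrow> RConj F \<approx>\<^sub>\<alpha> RConj G"
| Neg: "X \<approx>\<^sub>\<alpha> Y \<Longrightarrow> RNeg X \<approx>\<^sub>\<alpha> RNeg Y"
| All: "X \<approx>\<^sub>\<alpha> Y \<Longrightarrow> RAll a X \<approx>\<^sub>\<alpha> RAll a Y"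
| Elem: "x \<approx>\<^sub>\<alpha> y \<Longrightarrow> RElem x a \<approx>\<^sub>\<alpha> RElem y a"
| Comp: "X \<approx>\<^sub>\<alpha> Y \<Longrightarrow> RComp a X \<approx>\<^sub>\<alpha> RComp a Y"
| rename_All: "level a = level b \<Longrightarrow> b \<notin> rfree X \<Longrightarrow>
               RAll a X \<approx>\<^sub>\<alpha> RAll b (map_raw (swap_atom a b) X)"
| rename_Comp: "level a = level b \<Longrightarrow> b \<notin> rfree X \<Longrightarrow>
               RComp a X \<approx>\<^sub>\<alpha> RComp b (map_raw (swap_atom a b) X)"

lemmas alpha_cong = alpha.refl alpha.Conj alpha.Neg alpha.All alpha.Elem alpha.Comp

definition lperm :: "('a::atom \<Rightarrow> 'a) \<Rightarrow> bool" where
  "lperm f \<longleftrightarrow> bij f \<and> (\<forall>a. level (f a) = level a)"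

lemma lperm_swap [simp]: "lperm (swap_atom a b)"
  unfolding lperm_def swap_atom_def by (auto simp: transpose_eq_iff bij_transpose) (metis transpose_apply_other transpose_apply_first transpose_apply_second)

lemma lperm_level [simp]: "lperm f \<Longrightarrow> level (f a) = level a"
  by (simp add: lperm_def)

lemma lperm_eq [simp]: "lperm f \<Longrightarrow> f a = f b \<longleftrightarrow> a = b"
  by (metis lperm_def bij_pointE)

lemma lperm_inj: "lperm f \<Longrightarrow> inj f"
  by (simp add: lperm_def bij_is_inj)

lemma swap_atom_conj: "lperm f \<Longrightarrow> f \<circ> swap_atom a b = swap_atom (f a) (f b) \<circ> f"
  by (rule ext) (auto simp: swap_atom_def transpose_def)

lemma swap_atom_invol [simp]: "swap_atom a b (swap_atom a b c) = c"
  by (auto simp: swap_atom_def)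

lemma swap_atom_comp_invol [simp]: "swap_atom a b \<circ> swap_atom a b = id"
  by (rule ext) simp

lemma swap_atom_self [simp]: "swap_atom a a = id"
  by (auto simp: swap_atom_def)

lemma swap_atom_commute: "swap_atom a b = swap_atom b a"
  by (auto simp: swap_atom_def transpose_commute)

lemma swap_atom_other: "c \<noteq> a \<Longrightarrow> c \<noteq> b \<Longrightarrow> swap_atom a b c = c"
  by (auto simp: swap_atom_def)

lemma swap_atom_left [simp]: "level a = level b \<Longrightarrow> swap_atom a b a = b"
  by (auto simp: swap_atom_def)

lemma swap_atom_right [simp]: "level a = level b \<Longrightarrow> swap_atom a b b = a"
  by (auto simp: swap_atom_def)

lemma rfree_map: "lperm f \<Longrightarrow> rfree (map_raw f X) = f ` rfree X"
  by (induction X) (auto simp: image_set_diff[OF lperm_inj])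

lemma finite_rfree: "finite (rfree X)"
  by (induction X) auto

lemma alpha_map: "X \<approx>\<^sub>\<alpha> Y \<Longrightarrow> lperm f \<Longrightarrow> map_raw f X \<approx>\<^sub>\<alpha> map_raw f Y"
proof (induction rule: alpha.induct)
  case (Conj F G)
  show ?case
    unfolding raw.map
  proof (rule alpha.Conj)
    fix X assume "X |\<in>| map_raw f |`| F"
    then show "\<exists>Y. Y |\<in>| map_raw f |`| G \<and> X \<approx>\<^sub>\<alpha> Y"
      using Conj by (metis fimageE fimageI)
  next
    fix Y assume "Y |\<in>| map_raw f |`| G"
    then show "\<exists>X. X |\<in>| map_raw f |`| F \<and> X \<approx>\<^sub>\<alpha> Y"
      using Conj by (metis fimageE fimageI)
  qed
next
  case (rename_All a b X)
  then show ?case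
    using alpha.rename_All[of "f a" "f b" "map_raw f X"]
    by (simp add: rfree_map raw.map_comp swap_atom_conj image_iff)
next
  case (rename_Comp a b X)
  then show ?case
    using alpha.rename_Comp[of "f a" "f b" "map_raw f X"]
    by (simp add: rfree_map raw.map_comp swap_atom_conj image_iff)
next
  case (trans X Y Z) then show ?case by (blast intro: alpha.trans)
next
  case (sym X Y) then show ?case by (blast intro: alpha.sym)
qed (auto intro: alpha_cong)

lemma alpha_rename_sym:
  assumes "level a = level b" "b \<notin> rfree X \<or> b = a"
  shows "RAll b (map_raw (swap_atom a b) X) \<approx>\<^sub>\<alpha> RAll a X"
    and "RComp b (map_raw (swap_atom a b) X) \<approx>\<^sub>\<alpha> RComp a X"
  using assms alpha.sym[OF alpha.rename_All[of a b X]] alpha.sym[OF alpha.rename_Comp[of a b X]]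
  by (auto simp: raw.map_id alpha.refl)

lemma alpha_swap_fresh:
  "level a = level b \<Longrightarrow> a \<notin> rfree X \<Longrightarrow> b \<notin> rfree X \<Longrightarrow> map_raw (swap_atom a b) X \<approx>\<^sub>\<alpha> X"
proof (induction X)
  case (RConj F)
  have "map_raw (swap_atom a b) X \<approx>\<^sub>\<alpha> X" if "X |\<in>| F" for X
    using RConj that by auto
  then show ?case
    by (auto intro!: alpha.Conj)
next
  case (RAll c X)
  consider "c \<noteq> a" "c \<noteq> b" | "c = a" "b \<notin> rfree X \<or> b = a" | "c = b" "a \<notin> rfree X \<or> a = b"
    using RAll.prems by auto
  then show ?case
  proof cases
    case 1
    then show ?thesis using RAll by (simp add: swap_atom_other alpha.All)
  next
    case 2
    then show ?thesis using RAll.prems alpha_rename_sym(1)[of a b X] by simp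
  next
    case 3
    then show ?thesis using RAll.prems alpha_rename_sym(1)[of b a X]
      by (simp add: swap_atom_commute[of b a])
  qed
next
  case (RComp c X)
  consider "c \<noteq> a" "c \<noteq> b" | "c = a" "b \<notin> rfree X \<or> b = a" | "c = b" "a \<notin> rfree X \<or> a = b"
    using RComp.prems by auto
  then show ?case
  proof cases
    case 1
    then show ?thesis using RComp by (simp add: swap_atom_other alpha.Comp)
  next
    case 2
    then show ?thesis using RComp.prems alpha_rename_sym(2)[of a b X] by simp
  next
    case 3
    then show ?thesis using RComp.prems alpha_rename_sym(2)[of b a X]
      by (simp add: swap_atom_commute[of b a])
  qed
qed (auto simp: swap_atom_other intro: alpha_cong)

lemma rfree_rename:
  assumes "level a = level b" "b \<notin> rfree X"
  shows "swap_atom a b ` rfree X - {b} = rfree X - {a}"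
proof -
  have "swap_atom a b ` rfree X - {b} = swap_atom a b ` (rfree X - {a})"
    using assms by (simp add: image_set_diff[OF lperm_inj])
  also have "\<dots> = (\<lambda>x. x) ` (rfree X - {a})"
    using assms by (intro image_cong refl swap_atom_other) auto
  finally show ?thesis by simp
qed

lemma alpha_rfree: "X \<approx>\<^sub>\<alpha> Y \<Longrightarrow> rfree X = rfree Y"
proof (induction rule: alpha.induct)
  case (Conj F G)
  have "rfree ` fset F = rfree ` fset G"
    by (intro set_eqI iffI; elim imageE) (metis Conj imageI)+
  then show ?case by simp
qed (simp_all add: rfree_map rfree_rename)

definition bind_eq :: "'a::atom \<Rightarrow> 'a raw \<Rightarrow> 'a \<Rightarrow> 'a raw \<Rightarrow> bool" where
  "bind_eq a X b Y \<longleftrightarrow> level a = level b \<and>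
    (\<exists>S. finite S \<and> (\<forall>c. c \<notin> S \<longrightarrow> level c = level a \<longrightarrow>
       map_raw (swap_atom c a) X \<approx>\<^sub>\<alpha> map_raw (swap_atom c b) Y))"

fun shape :: "'a::atom raw \<Rightarrow> 'a raw \<Rightarrow> bool" where
  "shape (RConj F) (RConj G) \<longleftrightarrow> rel_fset (\<approx>\<^sub>\<alpha>) F G"
| "shape (RNeg X) (RNeg Y) \<longleftrightarrow> X \<approx>\<^sub>\<alpha> Y"
| "shape (RAll a X) (RAll b Y) \<longleftrightarrow> bind_eq a X b Y"
| "shape (RElem x a) (RElem y b) \<longleftrightarrow> x \<approx>\<^sub>\<alpha> y \<and> a = b"
| "shape (RAtm a) (RAtm b) \<longleftrightarrow> a = b"
| "shape (RComp a X) (RComp b Y) \<longleftrightarrow> bind_eq a X b Y"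
| "shape _ _ \<longleftrightarrow> False"

lemma equivp_alpha: "equivp (\<approx>\<^sub>\<alpha>)"
  by (intro equivpI reflpI sympI transpI) (blast intro: alpha.refl alpha.sym alpha.trans)+

lemma bind_eq_refl: "bind_eq a X a X"
  by (auto simp: bind_eq_def intro: alpha_cong)

lemma bind_eq_sym: "bind_eq a X b Y \<Longrightarrow> bind_eq b Y a X"
  unfolding bind_eq_def by (metis alpha.sym)

lemma bind_eq_trans:
  assumes "bind_eq a X b Y" "bind_eq b Y c Z" shows "bind_eq a X c Z"
proof -
  obtain S T where "finite S" "finite T"
    "\<And>d. d \<notin> S \<Longrightarrow> level d = level a \<Longrightarrow> map_raw (swap_atom d a) X \<approx>\<^sub>\<alpha> map_raw (swap_atom d b) Y"
    "\<And>d. d \<notin> T \<Longrightarrow> level d = level b \<Longrightarrow> map_raw (swap_atom d b) Y \<approx>\<^sub>\<alpha> map_raw (swap_atom d c) Z"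
    and l: "level a = level b" "level b = level c"
    using assms unfolding bind_eq_def by metis
  then have "\<forall>d. d \<notin> S \<union> T \<longrightarrow> level d = level a \<longrightarrow>
       map_raw (swap_atom d a) X \<approx>\<^sub>\<alpha> map_raw (swap_atom d c) Z"
    by (metis UnCI alpha.trans)
  then show ?thesis unfolding bind_eq_def using l \<open>finite S\<close> \<open>finite T\<close>
    by (metis finite_UnI)
qed

lemma bind_eq_alpha: "X \<approx>\<^sub>\<alpha> Y \<Longrightarrow> bind_eq a X a Y"
  by (auto simp: bind_eq_def intro!: exI[of _ "{}"] alpha_map)

lemma bind_eq_rename:
  assumes "level a = level b" "b \<notin> rfree X"
  shows "bind_eq a X b (map_raw (swap_atom a b) X)"
proof (cases "a = b")
  case True
  then show ?thesis by (simp add: raw.map_id bind_eq_refl)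
next
  case False
  have "map_raw (swap_atom c a) X \<approx>\<^sub>\<alpha> map_raw (swap_atom c b) (map_raw (swap_atom a b) X)"
    if "c \<notin> rfree X \<union> {a,b}" "level c = level a" for c
  proof -
    have "map_raw (swap_atom c b) X \<approx>\<^sub>\<alpha> X"
      using that assms by (intro alpha_swap_fresh) auto
    then have "map_raw (swap_atom c a) (map_raw (swap_atom c b) X) \<approx>\<^sub>\<alpha> map_raw (swap_atom c a) X"
      by (rule alpha_map) simp
    moreover have "swap_atom c b \<circ> swap_atom a b = swap_atom c a \<circ> swap_atom c b"
      using that assms False by (intro ext) (auto simp: swap_atom_def transpose_def)
    ultimately show ?thesis by (simp add: raw.map_comp alpha.sym)
  qed
  moreover have "finite (rfree X \<union> {a,b})" by (simp add: finite_rfree)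
  ultimately show ?thesis unfolding bind_eq_def using assms by blast
qed

lemma shape_refl: "shape X X"
  by (cases X) (auto simp: bind_eq_refl rel_fset_alt_def intro: alpha.refl)

lemma shape_sym: "shape X Y \<Longrightarrow> shape Y X"
  by (cases X; cases Y; simp add: rel_fset_alt_def; blast intro: alpha.sym bind_eq_sym)

lemma rel_fset_alpha_trans:
  assumes "rel_fset (\<approx>\<^sub>\<alpha>) F G" "rel_fset (\<approx>\<^sub>\<alpha>) G H" shows "rel_fset (\<approx>\<^sub>\<alpha>) F H"
proof -
  have "((\<approx>\<^sub>\<alpha>) OO (\<approx>\<^sub>\<alpha>) :: 'a raw \<Rightarrow> 'a raw \<Rightarrow> bool) \<le> (\<approx>\<^sub>\<alpha>)"
    by (auto intro: alpha.trans)
  from fset.rel_mono[OF this] assms show ?thesis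
    by (auto simp: fset.rel_compp)
qed

lemma shape_trans: "shape X Y \<Longrightarrow> shape Y Z \<Longrightarrow> shape X Z"
  by (cases X; cases Y; simp; cases Z; simp; blast intro: rel_fset_alpha_trans alpha.trans bind_eq_trans)

lemma alpha_shape: "X \<approx>\<^sub>\<alpha> Y \<Longrightarrow> shape X Y"
proof (induction rule: alpha.induct)
  case (sym X Y) then show ?case by (blast intro: shape_sym)
next
  case (trans X Y Z) then show ?case by (blast intro: shape_trans)
next
  case (Conj F G) then show ?case by (auto simp: rel_fset_alt_def)
qed (auto simp: shape_refl bind_eq_alpha bind_eq_rename)

text \<open>
  In the quotient, \<open>Forall a X\<close> is the internal predicate $\forall[a]X$, \<open>Elem x a\<close> is ${\in}(x,a)$
  and \<open>Comp a X\<close> is the internal set (comprehension) $[a]X$.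
\<close>

quotient_type (overloaded) 'a expr = "'a::atom raw" / "(\<approx>\<^sub>\<alpha>)"
  by (rule equivp_alpha)

lift_definition Conj :: "'a::atom expr fset \<Rightarrow> 'a expr" is RConj
  by (auto simp: rel_fset_alt_def intro!: alpha.Conj)
lift_definition Neg :: "'a::atom expr \<Rightarrow> 'a expr" is RNeg
  by (rule alpha.Neg)
lift_definition Forall :: "'a::atom \<Rightarrow> 'a expr \<Rightarrow> 'a expr" is RAll
  by (rule alpha.All)
lift_definition Elem :: "'a::atom expr \<Rightarrow> 'a \<Rightarrow> 'a expr" is RElem
  by (rule alpha.Elem)
lift_definition Atm :: "'a::atom \<Rightarrow> 'a expr" is RAtm .
lift_definition Comp :: "'a::atom \<Rightarrow> 'a expr \<Rightarrow> 'a expr" is RComp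
  by (rule alpha.Comp)

text \<open>\<open>swap a b Z\<close> is $(a\ b)\cdot Z$.\<close>

lift_definition swap :: "'a::atom \<Rightarrow> 'a \<Rightarrow> 'a expr \<Rightarrow> 'a expr" is "\<lambda>a b. map_raw (swap_atom a b)"
  by (simp add: alpha_map)

lift_definition free :: "'a::atom expr \<Rightarrow> 'a set" is rfree
  by (rule alpha_rfree)

definition fresh :: "'a::atom \<Rightarrow> 'a expr \<Rightarrow> bool" (infix "\<sharp>" 55) where
  "a \<sharp> Z \<longleftrightarrow> a \<notin> free Z"

text \<open>The rank is for induction, and the set of the levels of all atoms, free or bound, for the
  termination of substitution.\<close>

primrec rrank :: "'a raw \<Rightarrow> nat" where
  "rrank (RConj F) = Suc (Max (insert 0 (fset (rrank |`| F))))"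
| "rrank (RNeg X) = Suc (rrank X)"
| "rrank (RAll a X) = Suc (rrank X)"
| "rrank (RElem x a) = Suc (rrank x)"
| "rrank (RAtm a) = 0"
| "rrank (RComp a X) = Suc (rrank X)"

lemma rrank_map [simp]: "rrank (map_raw f X) = rrank X"
proof (induction X)
  case (RConj F)
  then have "(\<lambda>x. rrank (map_raw f x)) ` fset F = rrank ` fset F"
    by (intro image_cong) auto
  then show ?case by (simp add: image_image)
qed auto

lift_definition rank :: "'a::atom expr \<Rightarrow> nat" is rrank
proof -
  show "rrank X = rrank Y" if "X \<approx>\<^sub>\<alpha> Y" for X Y :: "'a raw"
    using that
  proof (induction rule: alpha.induct)
    case (Conj F G)
    have "rrank ` fset F = rrank ` fset G"
      by (intro set_eqI iffI; elim imageE) (metis Conj imageI)+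
    then show ?case by simp
  qed auto
qed

lemma levels_map_raw: "lperm f \<Longrightarrow> level ` set_raw (map_raw f X) = level ` set_raw X"
  by (simp add: raw.set_map image_image)

lift_definition levels :: "'a::atom expr \<Rightarrow> int set" is "\<lambda>X. level ` set_raw X"
proof -
  show "level ` set_raw X = level ` set_raw Y" if "X \<approx>\<^sub>\<alpha> Y" for X Y :: "'a raw"
    using that
  proof (induction rule: alpha.induct)
    case (Conj F G)
    have "(\<lambda>X. level ` set_raw X) ` fset F = (\<lambda>X. level ` set_raw X) ` fset G"
      by (intro set_eqI iffI; elim imageE) (metis Conj imageI)+
    then have "(\<Union>X\<in>fset F. level ` set_raw X) = (\<Union>X\<in>fset G. level ` set_raw X)"
      by (rule arg_cong)
    then show ?case by (simp only: raw.set image_UN)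
  next
    case (sym X Y) then show ?case by simp
  next
    case (trans X Y Z) then show ?case by simp
  qed (simp_all only: raw.set levels_map_raw image_insert image_Un image_empty lperm_swap)
qed

lemma alpha_raw_iff:
  "RConj F \<approx>\<^sub>\<alpha> RConj G \<longleftrightarrow> rel_fset (\<approx>\<^sub>\<alpha>) F G"
  "RNeg X \<approx>\<^sub>\<alpha> RNeg Y \<longleftrightarrow> X \<approx>\<^sub>\<alpha> Y"
  "RElem X a \<approx>\<^sub>\<alpha> RElem Y b \<longleftrightarrow> X \<approx>\<^sub>\<alpha> Y \<and> a = b"
  "RAtm a \<approx>\<^sub>\<alpha> RAtm b \<longleftrightarrow> a = b"
     apply (rule iffI)
      apply (drule alpha_shape, simp)
     apply (rule alpha.Conj; simp add: rel_fset_alt_def)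
    apply (rule iffI)
     apply (drule alpha_shape, simp)
    apply (erule alpha.Neg)
   apply (rule iffI)
    apply (drule alpha_shape, simp)
   apply (simp add: alpha.Elem)
  apply (rule iffI)
   apply (drule alpha_shape, simp)
  apply (simp add: alpha.refl)
  done

lemma rep_expr_alpha: "rep_expr X \<approx>\<^sub>\<alpha> rep_expr Y \<longleftrightarrow> X = Y"
  by (rule Quotient_rel_rep[OF Quotient_expr])

lemma Conj_eq [simp]: "Conj F = Conj G \<longleftrightarrow> F = G"
proof
  assume "Conj F = Conj G"
  then have "RConj (rep_expr |`| F) \<approx>\<^sub>\<alpha> RConj (rep_expr |`| G)"
    by (simp add: Conj_def expr.abs_eq_iff)
  then have "rel_fset (\<approx>\<^sub>\<alpha>) (rep_expr |`| F) (rep_expr |`| G)"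
    by (simp only: alpha_raw_iff)
  then have "(\<forall>X. X |\<in>| F \<longrightarrow> X |\<in>| G) \<and> (\<forall>X. X |\<in>| G \<longrightarrow> X |\<in>| F)"
    by (auto simp: rel_fset_alt_def rep_expr_alpha)
  then show "F = G" by (intro fset_eqI) blast
qed simp
lemma Neg_eq [simp]: "Neg X = Neg Y \<longleftrightarrow> X = Y"
  by transfer (rule alpha_raw_iff)
lemma Elem_eq [simp]: "Elem x a = Elem y b \<longleftrightarrow> x = y \<and> a = b"
  by transfer (rule alpha_raw_iff)
lemma Atm_eq [simp]: "Atm a = Atm b \<longleftrightarrow> a = b"
  by transfer (rule alpha_raw_iff)

lemma Forall_eqD:
  assumes "Forall a X = Forall b Y"
  shows "level a = level b \<and> (\<exists>S. finite S \<and> (\<forall>c. c \<notin> S \<longrightarrow> level c = level a \<longrightarrow> swap c a X = swap c b Y))"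
proof -
  obtain x y where xy: "X = abs_expr x" "Y = abs_expr y"
    by (metis Quotient_abs_rep[OF Quotient_expr])
  have "RAll a x \<approx>\<^sub>\<alpha> RAll b y"
    using assms unfolding xy Forall.abs_eq expr.abs_eq_iff .
  then have "bind_eq a x b y"
    by (drule_tac alpha_shape) (simp only: shape.simps)
  then show ?thesis
    unfolding xy bind_eq_def swap.abs_eq expr.abs_eq_iff .
qed

lemma Comp_eqD:
  assumes "Comp a X = Comp b Y"
  shows "level a = level b \<and> (\<exists>S. finite S \<and> (\<forall>c. c \<notin> S \<longrightarrow> level c = level a \<longrightarrow> swap c a X = swap c b Y))"
proof -
  obtain x y where xy: "X = abs_expr x" "Y = abs_expr y"
    by (metis Quotient_abs_rep[OF Quotient_expr])
  have "RComp a x \<approx>\<^sub>\<alpha> RComp b y"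
    using assms unfolding xy Comp.abs_eq expr.abs_eq_iff .
  then have "bind_eq a x b y"
    by (drule_tac alpha_shape) (simp only: shape.simps)
  then show ?thesis
    unfolding xy bind_eq_def swap.abs_eq expr.abs_eq_iff .
qed

lemma expr_distinct [simp]:
  "Conj F \<noteq> Neg X" "Conj F \<noteq> Forall a X" "Conj F \<noteq> Elem X a" "Conj F \<noteq> Atm a" "Conj F \<noteq> Comp a X"
  "Neg Y \<noteq> Conj F" "Neg Y \<noteq> Forall a X" "Neg Y \<noteq> Elem X a" "Neg Y \<noteq> Atm a" "Neg Y \<noteq> Comp a X"
  "Forall b Y \<noteq> Conj F" "Forall b Y \<noteq> Neg X" "Forall b Y \<noteq> Elem X a" "Forall b Y \<noteq> Atm a" "Forall b Y \<noteq> Comp a X"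
  "Elem Y b \<noteq> Conj F" "Elem Y b \<noteq> Neg X" "Elem Y b \<noteq> Forall a X" "Elem Y b \<noteq> Atm a" "Elem Y b \<noteq> Comp a X"
  "Atm b \<noteq> Conj F" "Atm b \<noteq> Neg X" "Atm b \<noteq> Forall a X" "Atm b \<noteq> Elem X a" "Atm b \<noteq> Comp a X"
  "Comp b Y \<noteq> Conj F" "Comp b Y \<noteq> Neg X" "Comp b Y \<noteq> Forall a X" "Comp b Y \<noteq> Elem X a" "Comp b Y \<noteq> Atm a"
  by (transfer, rule notI, drule alpha_shape, simp)+

lemma raw_exhaust_alpha:
  "(\<exists>F. Z \<approx>\<^sub>\<alpha> RConj F) \<or> (\<exists>X. Z \<approx>\<^sub>\<alpha> RNeg X) \<or> (\<exists>a X. Z \<approx>\<^sub>\<alpha> RAll a X)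
   \<or> (\<exists>x a. Z \<approx>\<^sub>\<alpha> RElem x a) \<or> (\<exists>a. Z \<approx>\<^sub>\<alpha> RAtm a) \<or> (\<exists>a X. Z \<approx>\<^sub>\<alpha> RComp a X)"
  by (cases Z) (metis alpha.refl)+

lemma expr_exhaust [case_names Conj Neg Forall Elem Atm Comp]:
  obtains F where "Z = Conj F" | X where "Z = Neg X" | a X where "Z = Forall a X"
    | x a where "Z = Elem x a" | a where "Z = Atm a" | a X where "Z = Comp a X"
proof -
  have "(\<exists>F. Z = Conj F) \<or> (\<exists>X. Z = Neg X) \<or> (\<exists>a X. Z = Forall a X)
   \<or> (\<exists>x a. Z = Elem x a) \<or> (\<exists>a. Z = Atm a) \<or> (\<exists>a X. Z = Comp a X)"
    by transfer (rule raw_exhaust_alpha)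
  then show ?thesis using that by blast
qed

lemma swap_simps [simp]:
  "swap a b (Conj F) = Conj (swap a b |`| F)"
  "swap a b (Neg X) = Neg (swap a b X)"
  "swap a b (Forall c X) = Forall (swap_atom a b c) (swap a b X)"
  "swap a b (Elem x c) = Elem (swap a b x) (swap_atom a b c)"
  "swap a b (Atm c) = Atm (swap_atom a b c)"
  "swap a b (Comp c X) = Comp (swap_atom a b c) (swap a b X)"
  by (transfer, simp add: alpha.refl)+

lemma free_simps [simp]:
  "free (Conj F) = \<Union> (free ` fset F)"
  "free (Neg X) = free X"
  "free (Forall a X) = free X - {a}"
  "free (Elem x a) = insert a (free x)"
  "free (Atm a) = {a}"
  "free (Comp a X) = free X - {a}"
  by (transfer, simp)+

lemma rank_simps [simp]:
  "rank (Neg X) = Suc (rank X)"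
  "rank (Forall a X) = Suc (rank X)"
  "rank (Elem x a) = Suc (rank x)"
  "rank (Atm a) = 0"
  "rank (Comp a X) = Suc (rank X)"
  by (transfer, simp)+

lemma rank_Conj: "X |\<in>| F \<Longrightarrow> rank X < rank (Conj F)"
proof -
  have "rank (Conj F) = Suc (Max (insert 0 (rank ` fset F)))"
    by transfer simp
  then show "X |\<in>| F \<Longrightarrow> rank X < rank (Conj F)"
    by (simp add: less_Suc_eq_le)
qed

lemma levels_simps [simp]:
  "levels (Conj F) = \<Union> (levels ` fset F)"
  "levels (Neg X) = levels X"
  "levels (Forall a X) = insert (level a) (levels X)"
  "levels (Elem x a) = insert (level a) (levels x)"
  "levels (Atm a) = {level a}"
  "levels (Comp a X) = insert (level a) (levels X)"
  by (transfer, auto)+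

lemma rank_swap [simp]: "rank (swap a b X) = rank X"
  by transfer simp

lemma levels_swap [simp]: "levels (swap a b X) = levels X"
  by transfer (simp add: raw.set_map image_image)

lemma finite_free [simp]: "finite (free X)"
  by transfer (rule finite_rfree)

lemma finite_levels: "finite (levels X)"
proof -
  have "finite (set_raw X)" for X :: "'a raw" by (induction X) auto
  then show ?thesis by (transfer, blast)
qed

lemma free_swap: "free (swap a b X) = swap_atom a b ` free X"
  by transfer (simp add: rfree_map)

lemma fresh_swap: "level a = level b \<Longrightarrow> a \<sharp> X \<Longrightarrow> b \<sharp> X \<Longrightarrow> swap a b X = X"
  unfolding fresh_def by transfer (rule alpha_swap_fresh)

lemma swap_swap [simp]: "swap a b (swap a b X) = X"
  by transfer (simp add: raw.map_comp raw.map_id alpha.refl)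

lemma swap_self [simp]: "swap a a X = X"
  by transfer (simp add: raw.map_id alpha.refl)

lemma swap_commute: "swap a b X = swap b a X"
  by transfer (simp add: swap_atom_commute alpha.refl)

lemma raw_swap_conj: "map_raw (swap_atom a b) (map_raw (swap_atom c d) X) =
  map_raw (swap_atom (swap_atom a b c) (swap_atom a b d)) (map_raw (swap_atom a b) X)"
  unfolding raw.map_comp by (subst swap_atom_conj) simp_all

lemma swap_conj: "swap a b (swap c d X) = swap (swap_atom a b c) (swap_atom a b d) (swap a b X)"
  by transfer (subst raw_swap_conj, rule alpha.refl)

lemma Forall_rename: "level a = level b \<Longrightarrow> b \<sharp> X \<Longrightarrow> Forall a X = Forall b (swap a b X)"
  unfolding fresh_def by transfer (rule alpha.rename_All)
lemma Comp_rename: "level a = level b \<Longrightarrow> b \<sharp> X \<Longrightarrow> Comp a X = Comp b (swap a b X)"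
  unfolding fresh_def by transfer (rule alpha.rename_Comp)

lemma infinite_atoms: "infinite (\<A> i :: 'a::atom set)"
proof -
  have "beth_omega_card (\<A> i :: 'a set)"
    unfolding \<A>_def by (rule beth_omega_card_level)
  then obtain B :: "nat \<Rightarrow> 'a set" where B: "B 0 \<approx> (UNIV :: nat set)" "(\<A> i :: 'a set) = (\<Union>n. B n)"
    unfolding beth_omega_card_def by metis
  have "infinite (B 0)"
    using eqpoll_finite_iff[OF B(1)] by simp
  moreover have "B 0 \<subseteq> \<A> i" using B(2) by auto
  ultimately show ?thesis by (metis finite_subset)
qed

lemma ex_fresh_atom:
  fixes S :: "'a::atom set"
  assumes "finite S" obtains b where "level b = i" "b \<notin> S"
proof -
  have "infinite (\<A> i - S)" using infinite_atoms assms by (rule Diff_infinite_finite[rotated])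
  then have "\<A> i - S \<noteq> {}" by (rule infinite_imp_nonempty)
  then show ?thesis using that by (auto simp: \<A>_def)
qed

lemma small_Un_finite:
  fixes S :: "'a::atom set"
  assumes "small S" "finite T" shows "small (S \<union> T)"
proof (cases "finite S")
  case True
  then show ?thesis using assms finite_lesspoll_infinite[OF infinite_atoms] unfolding small_def by blast
next
  case False
  from \<open>finite T\<close> have "S \<union> T \<lesssim> S"
  proof (induction T)
    case (insert t T)
    have "S \<union> insert t T = insert t (S \<union> T)" by auto
    also have "\<dots> \<lesssim> S \<union> T"
      using False by (intro infinite_insert_lepoll) auto
    finally show ?case using insert.IH lepoll_trans by metis
  qed simp
  then show ?thesis using assms unfolding small_def by (metis lesspoll_trans1)
qed

lemma small_subset: "small T \<Longrightarrow> S \<subseteq> T \<Longrightarrow> small S"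
  unfolding small_def by (metis lesspoll_trans1 subset_imp_lepoll)

lemma New_cong_imp:
  assumes "finite S" "\<And>c. level c = i \<Longrightarrow> c \<notin> S \<Longrightarrow> \<Phi> c = \<Psi> c" "New i \<Phi>"
  shows "New i \<Psi>"
proof -
  have "\<A> i - {a \<in> \<A> i. \<Psi> a} \<subseteq> (\<A> i - {a \<in> \<A> i. \<Phi> a}) \<union> S"
    using assms(2) by (auto simp: \<A>_def)
  then show ?thesis
    using assms(1,3) small_Un_finite small_subset unfolding New_def by metis
qed

lemma New_cong:
  assumes "finite S" "\<And>c. level c = i \<Longrightarrow> c \<notin> S \<Longrightarrow> \<Phi> c = \<Psi> c"
  shows "New i \<Phi> = New i \<Psi>"
  using New_cong_imp[OF assms(1), of i \<Phi> \<Psi>] New_cong_imp[OF assms(1), of i \<Psi> \<Phi>] assms(2) by metis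

text \<open>\<open>is_set i x\<close> means that \<open>x\<close> is an internal set of level \<open>i\<close>.\<close>

inductive is_pred :: "'a::atom expr \<Rightarrow> bool"
  and is_set :: "int \<Rightarrow> 'a::atom expr \<Rightarrow> bool" where
  Conj: "(\<And>X. X |\<in>| F \<Longrightarrow> is_pred X) \<Longrightarrow> is_pred (Conj F)"
| Neg: "is_pred X \<Longrightarrow> is_pred (Neg X)"
| Forall: "is_pred X \<Longrightarrow> is_pred (Forall a X)"
| Elem: "a \<in> \<A> (i + 1) \<Longrightarrow> is_set i x \<Longrightarrow> is_pred (Elem x a)"
| Atm: "a \<in> \<A> i \<Longrightarrow> is_set i (Atm a)"
| Comp: "a \<in> \<A> (i - 1) \<Longrightarrow> is_pred X \<Longrightarrow> is_set i (Comp a X)"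

definition \<L> :: "int \<Rightarrow> 'a::atom expr set" where
  "\<L> i = {x. is_set i x}"

section \<open>Validity\<close>

text \<open>
  A pair \<open>(a, y)\<close> is what is written $a \triangleright y$ informally. The last two clauses concern
  internal sets, which are not predicates; their values are dummies.
\<close>

function sat :: "('a::atom \<times> 'a expr) set \<Rightarrow> 'a expr \<Rightarrow> bool" (infix "\<Turnstile>" 50) where
  "p \<Turnstile> Conj F \<longleftrightarrow> (\<forall>X. X |\<in>| F \<longrightarrow> p \<Turnstile> X)"
| "p \<Turnstile> Neg X \<longleftrightarrow> \<not> p \<Turnstile> X"
| "p \<Turnstile> Forall a X \<longleftrightarrow> New (level a) (\<lambda>a'. p \<Turnstile> swap a' a X)"
| "p \<Turnstile> Elem y a \<longleftrightarrow> (a, y) \<in> p"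
| "p \<Turnstile> Atm a \<longleftrightarrow> False"
| "p \<Turnstile> Comp a X \<longleftrightarrow> False"
proof goal_cases
  case (1 P x)
  then show ?case by (cases "snd x" rule: expr_exhaust; cases x) auto
next
  case (13 p a X q b Y)
  then have eq: "Forall a X = Forall b Y" "p = q" by auto
  from Forall_eqD[OF eq(1)] obtain S where
    S: "level a = level b" "finite S" "\<And>c. c \<notin> S \<Longrightarrow> level c = level a \<Longrightarrow> swap c a X = swap c b Y" by auto
  show ?case
    unfolding S(1) eq(2)
    by (rule New_cong[OF S(2)]) (use S(1,3) in auto)
qed auto
termination
  by (relation "measure (\<lambda>(p, X). rank X)") (auto simp: rank_Conj)

section \<open>Substitution\<close>

text \<open>
  The recursive clauses of substitution hold only up to the choice of fresh bound atoms, and the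
  recursion in \<open>Elem_Comp\<close> is not structural. So we define the graph of substitution inductively by
  these clauses. \<open>subst_rel_det\<close> and \<open>subst_rel_exists\<close> below show that it is the graph of a function
  on well-formed arguments, and \<open>subst_simps\<close> that this function satisfies the clauses.
  In \<open>Elem_Atm\<close>, \<open>n = a\<close> is allowed.
\<close>

inductive subst_rel :: "'a::atom expr \<Rightarrow> 'a \<Rightarrow> 'a expr \<Rightarrow> 'a expr \<Rightarrow> bool" where
  Conj: "(\<And>X. X |\<in>| F \<Longrightarrow> subst_rel X a x (f X)) \<Longrightarrow>
      subst_rel (Conj F) a x (Conj (f |`| F))"
| Neg: "subst_rel X a x Y \<Longrightarrow> subst_rel (Neg X) a x (Neg Y)"
| Forall: "subst_rel X a x Y \<Longrightarrow> b \<sharp> x \<Longrightarrow> b \<noteq> a \<Longrightarrow>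
      subst_rel (Forall b X) a x (Forall b Y)"
| Elem_Atm: "subst_rel y a (Atm n) y' \<Longrightarrow>
      subst_rel (Elem y a) a (Atm n) (Elem y' n)"
| Elem_Comp: "subst_rel y a (Comp a' X) y' \<Longrightarrow> subst_rel X a' y' Z \<Longrightarrow> a' \<sharp> y \<Longrightarrow> a' \<noteq> a \<Longrightarrow>
      subst_rel (Elem y a) a (Comp a' X) Z"
| Elem_other: "subst_rel y a x y' \<Longrightarrow> b \<noteq> a \<Longrightarrow>
      subst_rel (Elem y b) a x (Elem y' b)"
| Atm: "subst_rel (Atm a) a x x"
| Atm_other: "b \<noteq> a \<Longrightarrow> subst_rel (Atm b) a x (Atm b)"
| Comp: "subst_rel X a x Y \<Longrightarrow> c \<sharp> x \<Longrightarrow> c \<noteq> a \<Longrightarrow>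
      subst_rel (Comp c X) a x (Comp c Y)"

definition subst :: "'a::atom expr \<Rightarrow> 'a \<Rightarrow> 'a expr \<Rightarrow> 'a expr"
    ("_\<lbrakk>_ \<mapsto> _\<rbrakk>" [1000, 0, 0] 1000) where
  "Z\<lbrakk>a \<mapsto> x\<rbrakk> = (THE Z'. subst_rel Z a x Z')"

lemma level_swap_atom [simp]: "level (swap_atom a b c) = level c"
  by simp

lemma swap_atom_eq_iff [simp]: "swap_atom a b c = swap_atom a b d \<longleftrightarrow> c = d"
  by simp

lemma fresh_swap_iff [simp]: "swap_atom a b c \<sharp> swap a b X \<longleftrightarrow> c \<sharp> X"
  by (auto simp: fresh_def free_swap)

lemma subst_rel_free: "subst_rel Z a x Z' \<Longrightarrow> free Z' \<subseteq> (free Z - {a}) \<union> free x"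
proof (induction rule: subst_rel.induct)
  case (Conj F a x f)
  then show ?case by simp blast
qed auto

lemma subst_rel_swap:
  "subst_rel Z a x Z' \<Longrightarrow> subst_rel (swap c d Z) (swap_atom c d a) (swap c d x) (swap c d Z')"
proof (induction rule: subst_rel.induct)
  case (Conj F a x f)
  have "subst_rel (Conj (swap c d |`| F)) (swap_atom c d a) (swap c d x)
     (Conj ((\<lambda>X. swap c d (f (swap c d X))) |`| swap c d |`| F))"
    by (rule subst_rel.Conj) (use Conj in auto)
  moreover have "(\<lambda>X. swap c d (f (swap c d X))) |`| swap c d |`| F = swap c d |`| f |`| F"
    by (simp add: fset.map_comp comp_def)
  ultimately show ?case by (simp only: swap_simps)
qed (auto intro: subst_rel.intros simp del: swap_atom_other)

lemma subst_rel_swap_fresh: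
  assumes "subst_rel Z a x Z'" "level c = level d" "c \<sharp> x" "d \<sharp> x" "c \<noteq> a" "d \<noteq> a"
  shows "subst_rel (swap c d Z) a x (swap c d Z')"
  using subst_rel_swap[OF assms(1), of c d] assms
  by (simp add: fresh_swap swap_atom_other)

lemma subst_rel_binder_aux:
  assumes det: "\<And>Y2. subst_rel X a x Y2 \<Longrightarrow> Y = Y2"
    and b: "b \<sharp> x" "b \<noteq> a" and b2: "b2 \<sharp> x" "b2 \<noteq> a"
    and l: "level b = level b2"
    and S: "finite S" "\<And>c. c \<notin> S \<Longrightarrow> level c = level b \<Longrightarrow> swap c b X = swap c b2 X2"
    and Y2: "subst_rel X2 a x Y2"
  obtains c where "level c = level b" "c \<sharp> Y" "c \<sharp> Y2" "swap c b Y = swap c b2 Y2"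
proof -
  have "finite (S \<union> free x \<union> free Y \<union> free Y2 \<union> {a})" using S by simp
  then obtain c where c: "level c = level b" "c \<notin> S \<union> free x \<union> free Y \<union> free Y2 \<union> {a}"
    by (rule ex_fresh_atom)
  have "subst_rel (swap c b2 X2) a x (swap c b2 Y2)"
    using Y2 by (rule subst_rel_swap_fresh) (use c l b2 in \<open>auto simp: fresh_def\<close>)
  then have "subst_rel (swap c b (swap c b2 X2)) a x (swap c b (swap c b2 Y2))"
    by (rule subst_rel_swap_fresh) (use c l b in \<open>auto simp: fresh_def\<close>)
  moreover have "swap c b (swap c b2 X2) = X"
    using S(2)[of c] c by (metis UnCI swap_swap)
  ultimately have "Y = swap c b (swap c b2 Y2)" using det by simp
  then have "swap c b Y = swap c b2 Y2" by simp
  then show ?thesis using that[of c] c by (auto simp: fresh_def)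
qed

lemma subst_rel_det: "subst_rel Z a x Z1 \<Longrightarrow> subst_rel Z a x Z2 \<Longrightarrow> Z1 = Z2"
proof (induction arbitrary: Z2 rule: subst_rel.induct)
  case (Conj F a x f)
  from Conj.prems show ?case
  proof cases
    case (Conj F' f')
    then show ?thesis using \<open>\<And>X Z2. X |\<in>| F \<Longrightarrow> subst_rel X a x Z2 \<Longrightarrow> f X = Z2\<close>
      by (auto intro!: fset.map_cong0)
  qed simp_all
next
  case (Neg X a x Y)
  from Neg.prems show ?case by cases (auto dest: Neg.IH)
next
  case (Forall X a x Y b)
  from Forall.prems show ?case
  proof cases
    case (Forall X2 Y2 b2)
    note * = Forall
    from Forall_eqD[OF *(1)] obtain S where S: "level b = level b2" "finite S"
      "\<And>c. c \<notin> S \<Longrightarrow> level c = level b \<Longrightarrow> swap c b X = swap c b2 X2" by auto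
    obtain c where c: "level c = level b" "c \<sharp> Y" "c \<sharp> Y2" "swap c b Y = swap c b2 Y2"
      by (rule subst_rel_binder_aux[OF Forall.IH Forall.hyps(2,3) *(4,5) S *(3)])
    have "Forall b Y = Forall c (swap b c Y)" using c by (intro Forall_rename) auto
    also have "\<dots> = Forall c (swap b2 c Y2)" using c(4) by (simp add: swap_commute)
    also have "\<dots> = Forall b2 Y2" using c S(1) by (intro Forall_rename[symmetric]) auto
    finally show ?thesis using * by simp
  qed simp_all
next
  case (Comp X a x Y b)
  from Comp.prems show ?case
  proof cases
    case (Comp X2 Y2 b2)
    note * = Comp
    from Comp_eqD[OF *(1)] obtain S where S: "level b = level b2" "finite S"
      "\<And>c. c \<notin> S \<Longrightarrow> level c = level b \<Longrightarrow> swap c b X = swap c b2 X2" by auto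
    obtain c where c: "level c = level b" "c \<sharp> Y" "c \<sharp> Y2" "swap c b Y = swap c b2 Y2"
      by (rule subst_rel_binder_aux[OF Comp.IH Comp.hyps(2,3) *(4,5) S *(3)])
    have "Comp b Y = Comp c (swap b c Y)" using c by (intro Comp_rename) auto
    also have "\<dots> = Comp c (swap b2 c Y2)" using c(4) by (simp add: swap_commute)
    also have "\<dots> = Comp b2 Y2" using c S(1) by (intro Comp_rename[symmetric]) auto
    finally show ?thesis using * by simp
  qed simp_all
next
  case (Elem_Atm y a n y')
  from Elem_Atm.prems show ?case by cases (auto dest: Elem_Atm.IH)
next
  case (Elem_Comp y a a' X y' Z)
  from Elem_Comp.prems show ?case
  proof cases
    case (Elem_Comp y2 a2 X2 y2')
    note * = this
    have y: "y2' = y'" using * Elem_Comp.IH(1)[of y2'] by simp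
    have eq: "Comp a' X = Comp a2 X2" using * by simp
    from Comp_eqD[OF eq] obtain S where S: "level a' = level a2" "finite S"
      "\<And>c. c \<notin> S \<Longrightarrow> level c = level a' \<Longrightarrow> swap c a' X = swap c a2 X2" by auto
    have "finite (S \<union> free y' \<union> free Z2 \<union> {a', a2})" using S by simp
    then obtain c where c: "level c = level a'" "c \<notin> S \<union> free y' \<union> free Z2 \<union> {a', a2}"
      by (rule ex_fresh_atom)
    have fr: "free X - {a'} = free X2 - {a2}" using eq by (metis free_simps(6))
    have y'f: "free y' \<subseteq> free y - {a} \<union> (free X - {a'})"
      using subst_rel_free[OF Elem_Comp.hyps(1)] by simp
    have r: "subst_rel X2 a2 y' Z2" using * y by simp
    have Z2f: "free Z2 \<subseteq> (free X - {a'}) \<union> free y'"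
      using subst_rel_free[OF r] fr by simp
    have fr': "a' \<sharp> y'" "a2 \<sharp> y'" "c \<sharp> y'" "a' \<sharp> Z2" "a2 \<sharp> Z2" "c \<sharp> Z2"
      using y'f Z2f fr c *(1,4,5) Elem_Comp.hyps(3) by (auto simp: fresh_def)
    have "subst_rel (swap c a2 X2) (swap_atom c a2 a2) (swap c a2 y') (swap c a2 Z2)"
      by (rule subst_rel_swap[OF r])
    then have "subst_rel (swap c a2 X2) c y' Z2"
      using fr' c S by (simp add: fresh_swap)
    then have "subst_rel (swap c a' (swap c a2 X2)) (swap_atom c a' c) (swap c a' y') (swap c a' Z2)"
      by (rule subst_rel_swap)
    moreover have "swap c a' (swap c a2 X2) = X"
      using S(3)[of c] c by (metis UnCI swap_swap)
    ultimately have "subst_rel X a' y' Z2"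
      using fr' c S by (simp add: fresh_swap)
    then show ?thesis by (rule Elem_Comp.IH(2))
  qed simp_all
next
  case (Elem_other y a x y' b)
  from Elem_other.prems Elem_other.hyps(2) show ?case by cases (auto dest: Elem_other.IH)
next
  case (Atm a x)
  from Atm.prems show ?case by cases simp_all
next
  case (Atm_other b a x)
  from Atm_other.prems Atm_other.hyps show ?case by cases simp_all
qed

lemma subst_eqI: "subst_rel Z a x Z' \<Longrightarrow> Z\<lbrakk>a \<mapsto> x\<rbrakk> = Z'"
  unfolding subst_def using subst_rel_det by blast

lemma is_pred_simps [simp]:
  "is_pred (Conj F) \<longleftrightarrow> (\<forall>X. X |\<in>| F \<longrightarrow> is_pred X)"
  "is_pred (Neg X) \<longleftrightarrow> is_pred X"
  "is_pred (Elem x a) \<longleftrightarrow> is_set (level a - 1) x"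
  "\<not> is_pred (Atm a)" "\<not> is_pred (Comp a X)"
  "\<not> is_set i (Conj F)" "\<not> is_set i (Neg X)" "\<not> is_set i (Forall a X)" "\<not> is_set i (Elem x a)"
  "is_set i (Atm a) \<longleftrightarrow> level a = i"
  by (auto simp: \<A>_def elim: is_pred.cases is_set.cases
      intro: is_pred_is_set.intros is_pred_is_set.Elem[where i = "level a - 1" and a = a])

lemma is_pred_swap_imp:
  "is_pred X \<Longrightarrow> is_pred (swap c d X)"
  "is_set i x \<Longrightarrow> is_set i (swap c d x)"
  by (induction rule: is_pred_is_set.inducts)
     (auto simp: \<A>_def intro: is_pred_is_set.intros)

lemma is_pred_swap [simp]:
  "is_pred (swap c d X) \<longleftrightarrow> is_pred X"
  "is_set i (swap c d x) \<longleftrightarrow> is_set i x"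
  by (metis is_pred_swap_imp swap_swap)+

lemma is_pred_binder [simp]:
  "is_pred (Forall a X) \<longleftrightarrow> is_pred X"
  "is_set i (Comp a X) \<longleftrightarrow> level a = i - 1 \<and> is_pred X"
proof -
  have *: "is_pred X" if S: "level a = level b" "finite S"
      "\<And>c. c \<notin> S \<Longrightarrow> level c = level a \<Longrightarrow> swap c a X = swap c b Y" and Y: "is_pred Y" for b S Y
  proof -
    obtain c where "level c = level a" "c \<notin> S" using ex_fresh_atom[OF \<open>finite S\<close>] .
    then show ?thesis using S(3)[of c] Y by (metis is_pred_swap(1))
  qed
  have "is_pred X" if "is_pred (Forall a X)"
    using that
  proof cases
    case (Forall Y b)
    then show ?thesis using Forall_eqD[OF Forall(1)] * by blast
  qed simp_all
  then show "is_pred (Forall a X) \<longleftrightarrow> is_pred X"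
    by (blast intro: is_pred_is_set.Forall)
  have "level a = i - 1 \<and> is_pred X" if "is_set i (Comp a X)"
    using that
  proof cases
    case (Comp b Y)
    from Comp_eqD[OF Comp(1)] Comp(3) * have "is_pred X" by blast
    with Comp Comp_eqD[OF Comp(1)] show ?thesis by (simp add: \<A>_def)
  qed simp_all
  then show "is_set i (Comp a X) \<longleftrightarrow> level a = i - 1 \<and> is_pred X"
    by (auto simp: \<A>_def intro: is_pred_is_set.Comp)
qed

lemma is_setE:
  assumes "is_set i x"
  obtains n where "x = Atm n" "level n = i" | a X where "x = Comp a X" "level a = i - 1" "is_pred X"
  using assms by (cases rule: is_set.cases) (auto simp: \<A>_def)

lemma Forall_fresh_rep:
  assumes "finite S" obtains b Y where "Forall a X = Forall b Y" "b \<notin> S" "level b = level a" "rank Y = rank X" "levels Y = levels X"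
proof -
  obtain b where b: "level b = level a" "b \<notin> S \<union> free X" using ex_fresh_atom[of "S \<union> free X"] assms by auto
  then show ?thesis using that[of b "swap a b X"] Forall_rename[of a b X] by (simp add: fresh_def)
qed

lemma Comp_fresh_rep:
  assumes "finite S" obtains b Y where "Comp a X = Comp b Y" "b \<notin> S" "level b = level a" "rank Y = rank X" "levels Y = levels X"
proof -
  obtain b where b: "level b = level a" "b \<notin> S \<union> free X" using ex_fresh_atom[of "S \<union> free X"] assms by auto
  then show ?thesis using that[of b "swap a b X"] Comp_rename[of a b X] by (simp add: fresh_def)
qed

lemma subst_rel_exists_aux:
  fixes Z x :: "'a::atom expr"
  assumes "is_pred Z \<or> (\<exists>i. is_set i Z)" "is_set (level a) x" "levels Z \<union> levels x \<subseteq> {m..}"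
  shows "\<exists>Z'. subst_rel Z a x Z' \<and> (is_pred Z \<longrightarrow> is_pred Z') \<and> (\<forall>i. is_set i Z \<longrightarrow> is_set i Z')
      \<and> levels Z' \<subseteq> {m..}"
  using assms
proof (induction "(a, Z)" arbitrary: a Z x
    rule: wf_induct_rule[OF wf_measures[of "[\<lambda>(a, Z). nat (level a - m + 1), \<lambda>(a, Z). rank Z]"]])
  case (1 a Z x)
  note IH = "1.hyps"(1)[simplified]
  note prems = "1.prems"
  show ?case
  proof (cases Z rule: expr_exhaust)
    case (Conj F)
    have F: "is_pred X" if "X |\<in>| F" for X using prems Conj that by auto
    have "\<exists>Y. subst_rel X a x Y \<and> is_pred Y \<and> levels Y \<subseteq> {m..}" if "X |\<in>| F" for X
      using IH[of a X x] F[OF that] that prems Conj rank_Conj[OF that] by auto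
    then obtain f where f: "\<And>X. X |\<in>| F \<Longrightarrow> subst_rel X a x (f X) \<and> is_pred (f X) \<and> levels (f X) \<subseteq> {m..}"
      by metis
    show ?thesis
      by (rule exI[of _ "Conj (f |`| F)"]) (use f Conj in \<open>auto intro: subst_rel.Conj\<close>)
  next
    case (Neg X)
    obtain Y where "subst_rel X a x Y" "is_pred Y" "levels Y \<subseteq> {m..}"
      using IH[of a X x] prems Neg by auto
    then show ?thesis
      by (intro exI[of _ "Neg Y"]) (use Neg in \<open>auto intro: subst_rel.Neg\<close>)
  next
    case (Forall b0 X0)
    obtain b X where bX: "Forall b0 X0 = Forall b X" "b \<notin> insert a (free x)" "level b = level b0"
        "rank X = rank X0" "levels X = levels X0"
      by (rule Forall_fresh_rep[of "insert a (free x)"]) auto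
    have Z: "Z = Forall b X" using Forall bX by simp
    obtain Y where "subst_rel X a x Y" "is_pred Y" "levels Y \<subseteq> {m..}"
      using IH[of a X x] prems Z by auto
    then show ?thesis
      by (intro exI[of _ "Forall b Y"])
         (use prems Z bX in \<open>auto simp: fresh_def intro: subst_rel.Forall\<close>)
  next
    case (Comp b0 X0)
    obtain b X where bX: "Comp b0 X0 = Comp b X" "b \<notin> insert a (free x)" "level b = level b0"
        "rank X = rank X0" "levels X = levels X0"
      by (rule Comp_fresh_rep[of "insert a (free x)"]) auto
    have Z: "Z = Comp b X" using Comp bX by simp
    obtain Y where "subst_rel X a x Y" "is_pred Y" "levels Y \<subseteq> {m..}"
      using IH[of a X x] prems Z by auto
    then show ?thesis
      by (intro exI[of _ "Comp b Y"])
         (use prems Z bX in \<open>auto simp: fresh_def intro: subst_rel.Comp\<close>)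
  next
    case (Atm b)
    then show ?thesis using prems
      by (cases "a = b") (force intro: subst_rel.Atm subst_rel.Atm_other)+
  next
    case (Elem y b)
    have y: "is_set (level b - 1) y" using prems Elem by auto
    obtain y' where y': "subst_rel y a x y'" "is_set (level b - 1) y'" "levels y' \<subseteq> {m..}"
      using IH[of a y x] y prems Elem by auto
    show ?thesis
    proof (cases "b = a")
      case False
      then show ?thesis
        by (intro exI[of _ "Elem y' b"])
           (use prems Elem y' in \<open>auto intro: subst_rel.Elem_other\<close>)
    next
      case True
      from prems(2) show ?thesis
      proof (cases rule: is_setE)
        case (1 n)
        then show ?thesis
          by (intro exI[of _ "Elem y' n"])
             (use prems Elem y' True in \<open>auto intro: subst_rel.Elem_Atm\<close>)
      next
        case (2 c0 X0)
        obtain c X where cX: "Comp c0 X0 = Comp c X" "c \<notin> insert a (free y)" "level c = level c0"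
            "rank X = rank X0" "levels X = levels X0"
          by (rule Comp_fresh_rep[of "insert a (free y)"]) auto
        have x: "x = Comp c X" using 2 cX by simp
        have X: "is_pred X" "level c = level a - 1" using prems(2) unfolding x by auto
        have "m \<le> level a" "levels X \<subseteq> {m..}" using prems(3) x Elem True by auto
        then obtain Z' where "subst_rel X c y' Z'" "is_pred Z'" "levels Z' \<subseteq> {m..}"
          using IH[of c X y'] X y' True by auto
        then show ?thesis
          by (intro exI[of _ Z'])
             (use Elem y'(1) True x cX(2) in \<open>auto simp: fresh_def intro: subst_rel.Elem_Comp\<close>)
      qed
    qed
  qed
qed

lemma subst_rel_exists:
  assumes "is_pred Z \<or> (\<exists>i. is_set i Z)" "is_set (level a) x"
  shows "\<exists>Z'. subst_rel Z a x Z' \<and> (is_pred Z \<longrightarrow> is_pred Z') \<and> (\<forall>i. is_set i Z \<longrightarrow> is_set i Z')"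
proof -
  have "finite (levels Z \<union> levels x)" by (simp add: finite_levels)
  then have "levels Z \<union> levels x \<subseteq> {Min (levels Z \<union> levels x)..}" by (meson Min_le atLeast_iff subsetI)
  from subst_rel_exists_aux[OF assms this] show ?thesis by blast
qed

lemma subst_sort:
  assumes "x \<in> \<L> (level a)"
  shows "is_pred Z \<Longrightarrow> is_pred (Z\<lbrakk>a \<mapsto> x\<rbrakk>)" "Z \<in> \<L> i \<Longrightarrow> Z\<lbrakk>a \<mapsto> x\<rbrakk> \<in> \<L> i"
  using subst_rel_exists[of Z a x] assms by (auto simp: \<L>_def dest: subst_eqI)

lemma subst_relI:
  assumes "is_pred Z \<or> Z \<in> \<L> i" "x \<in> \<L> (level a)"
  shows "subst_rel Z a x (Z\<lbrakk>a \<mapsto> x\<rbrakk>)"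
proof -
  have "is_pred Z \<or> (\<exists>i. is_set i Z)" "is_set (level a) x"
    using assms by (auto simp: \<L>_def)
  from subst_rel_exists[OF this] obtain Z' where Z': "subst_rel Z a x Z'" by blast
  with subst_eqI[OF Z'] show ?thesis by simp
qed

lemma subst_swap_fresh:
  assumes "is_pred Z \<or> Z \<in> \<L> i" "x \<in> \<L> (level a)"
      "level c = level d" "c \<sharp> x" "d \<sharp> x" "c \<noteq> a" "d \<noteq> a"
  shows "swap c d (Z\<lbrakk>a \<mapsto> x\<rbrakk>) = (swap c d Z)\<lbrakk>a \<mapsto> x\<rbrakk>"
  using subst_rel_swap_fresh[OF subst_relI[OF assms(1,2)] assms(3-7)] by (simp add: subst_eqI)

lemma subst_simps:
  assumes x: "x \<in> \<L> (level a)"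
  shows "is_pred (Conj F) \<Longrightarrow> (Conj F)\<lbrakk>a \<mapsto> x\<rbrakk> = Conj ((\<lambda>X. X\<lbrakk>a \<mapsto> x\<rbrakk>) |`| F)"
    and "is_pred X \<Longrightarrow> (Neg X)\<lbrakk>a \<mapsto> x\<rbrakk> = Neg (X\<lbrakk>a \<mapsto> x\<rbrakk>)"
    and "is_pred X \<Longrightarrow> b \<sharp> x \<Longrightarrow> b \<noteq> a \<Longrightarrow> (Forall b X)\<lbrakk>a \<mapsto> x\<rbrakk> = Forall b (X\<lbrakk>a \<mapsto> x\<rbrakk>)"
    and "y \<in> \<L> (level a - 1) \<Longrightarrow> x = Atm n \<Longrightarrow> (Elem y a)\<lbrakk>a \<mapsto> x\<rbrakk> = Elem (y\<lbrakk>a \<mapsto> x\<rbrakk>) n"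
    and "y \<in> \<L> (level a - 1) \<Longrightarrow> x = Comp a' X \<Longrightarrow> a' \<sharp> y \<Longrightarrow>
      (Elem y a)\<lbrakk>a \<mapsto> x\<rbrakk> = X\<lbrakk>a' \<mapsto> y\<lbrakk>a \<mapsto> x\<rbrakk>\<rbrakk>"
    and "y \<in> \<L> (level b - 1) \<Longrightarrow> b \<noteq> a \<Longrightarrow> (Elem y b)\<lbrakk>a \<mapsto> x\<rbrakk> = Elem (y\<lbrakk>a \<mapsto> x\<rbrakk>) b"
    and "(Atm a)\<lbrakk>a \<mapsto> x\<rbrakk> = x"
    and "b \<noteq> a \<Longrightarrow> (Atm b)\<lbrakk>a \<mapsto> x\<rbrakk> = Atm b"
    and "is_pred X \<Longrightarrow> c \<sharp> x \<Longrightarrow> c \<noteq> a \<Longrightarrow> (Comp c X)\<lbrakk>a \<mapsto> x\<rbrakk> = Comp c (X\<lbrakk>a \<mapsto> x\<rbrakk>)"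
proof -
  note r = subst_relI[OF _ x]
  show "is_pred (Conj F) \<Longrightarrow> (Conj F)\<lbrakk>a \<mapsto> x\<rbrakk> = Conj ((\<lambda>X. X\<lbrakk>a \<mapsto> x\<rbrakk>) |`| F)"
    by (intro subst_eqI subst_rel.Conj r) auto
  show "is_pred X \<Longrightarrow> (Neg X)\<lbrakk>a \<mapsto> x\<rbrakk> = Neg (X\<lbrakk>a \<mapsto> x\<rbrakk>)"
    by (intro subst_eqI subst_rel.Neg r) auto
  show "is_pred X \<Longrightarrow> b \<sharp> x \<Longrightarrow> b \<noteq> a \<Longrightarrow> (Forall b X)\<lbrakk>a \<mapsto> x\<rbrakk> = Forall b (X\<lbrakk>a \<mapsto> x\<rbrakk>)"
    by (intro subst_eqI subst_rel.Forall r) auto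
  show "y \<in> \<L> (level a - 1) \<Longrightarrow> x = Atm n \<Longrightarrow> (Elem y a)\<lbrakk>a \<mapsto> x\<rbrakk> = Elem (y\<lbrakk>a \<mapsto> x\<rbrakk>) n"
    using r[of y "level a - 1"] by (auto intro!: subst_eqI subst_rel.Elem_Atm)
  show "(Elem y a)\<lbrakk>a \<mapsto> x\<rbrakk> = X\<lbrakk>a' \<mapsto> y\<lbrakk>a \<mapsto> x\<rbrakk>\<rbrakk>"
    if y: "y \<in> \<L> (level a - 1)" and eq: "x = Comp a' X" and fr: "a' \<sharp> y"
  proof -
    have l: "level a' = level a - 1" "is_pred X" using x eq by (auto simp: \<L>_def)
    have "subst_rel X a' (y\<lbrakk>a \<mapsto> x\<rbrakk>) (X\<lbrakk>a' \<mapsto> y\<lbrakk>a \<mapsto> x\<rbrakk>\<rbrakk>)"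
      by (rule subst_relI) (use l subst_sort(2)[OF x y] in auto)
    then show ?thesis
      using r[of y "level a - 1"] y fr l(1) unfolding eq by (intro subst_eqI subst_rel.Elem_Comp) auto
  qed
  show "y \<in> \<L> (level b - 1) \<Longrightarrow> b \<noteq> a \<Longrightarrow> (Elem y b)\<lbrakk>a \<mapsto> x\<rbrakk> = Elem (y\<lbrakk>a \<mapsto> x\<rbrakk>) b"
    by (intro subst_eqI subst_rel.Elem_other r) auto
  show "(Atm a)\<lbrakk>a \<mapsto> x\<rbrakk> = x"
    by (intro subst_eqI subst_rel.Atm)
  show "b \<noteq> a \<Longrightarrow> (Atm b)\<lbrakk>a \<mapsto> x\<rbrakk> = Atm b"
    by (intro subst_eqI subst_rel.Atm_other)
  show "is_pred X \<Longrightarrow> c \<sharp> x \<Longrightarrow> c \<noteq> a \<Longrightarrow> (Comp c X)\<lbrakk>a \<mapsto> x\<rbrakk> = Comp c (X\<lbrakk>a \<mapsto> x\<rbrakk>)"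
    by (intro subst_eqI subst_rel.Comp r) auto
qed

section \<open>Prepoints\<close>

definition prepoint :: "('a::atom \<times> 'a expr) set \<Rightarrow> bool" where
  "prepoint p \<longleftrightarrow> p \<subseteq> (\<Union>i. \<A> i \<times> \<L> (i - 1))"

text \<open>
  In the second set, \<open>a'\<close> is fresh: it is distinct from \<open>a\<close>, which has a different level, and not free
  in \<open>x = Comp a' X\<close>. By \<open>subst_simps\<close> the value of the substitution does not depend on its choice.
\<close>

definition point_subst :: "('a::atom \<times> 'a expr) set \<Rightarrow> 'a expr \<Rightarrow> 'a \<Rightarrow> ('a \<times> 'a expr) set"
    ("_\<lbrakk>_ \<cdot> _\<rbrakk>" [1000, 0, 0] 1000) where
  "p\<lbrakk>x \<cdot> a\<rbrakk> =
     {(b, y). b \<noteq> a \<and> y \<in> \<L> (level b - 1) \<and> (b, y\<lbrakk>a \<mapsto> x\<rbrakk>) \<in> p} \<union>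
     {(a, y) | y a' X. y \<in> \<L> (level a - 1) \<and> x = Comp a' X \<and> a' \<sharp> y \<and>
        p \<Turnstile> X\<lbrakk>a' \<mapsto> y\<lbrakk>a \<mapsto> x\<rbrakk>\<rbrakk>} \<union>
     {(a, y) | y n. y \<in> \<L> (level a - 1) \<and> x = Atm n \<and> (n, y\<lbrakk>a \<mapsto> Atm n\<rbrakk>) \<in> p}"

end

theory Submission
  imports Defs
begin

text \<open>The set \<open>p\<lbrakk>x \<cdot> a\<rbrakk>\<close> is designed so that the claim
  holds for the predicates \<open>Elem y b\<close>; \<open>point_subst_iff\<close> checks this, with
  no induction even where substituting a comprehension unfolds \<open>Elem y a\<close> into a
  predicate of unrelated size. The general case, \<open>sat_subst_iff\<close>, is an induction on
  \<open>X\<close> with \<open>p\<close> fixed: substitution and validity both pass through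
  \<open>Conj\<close> and \<open>Neg\<close>, and under \<open>Forall\<close> substitution commutes
  with all but finitely many of the swappings, exceptions that \<open>New\<close> ignores.\<close>

lemma point_subst_iff:
  fixes a b :: "'a::atom"
  assumes x: "x \<in> \<L> (level a)" and y: "y \<in> \<L> (level b - 1)"
  shows "(b, y) \<in> p\<lbrakk>x \<cdot> a\<rbrakk> \<longleftrightarrow> p \<Turnstile> (Elem y b)\<lbrakk>a \<mapsto> x\<rbrakk>"
proof (cases "b = a")
  case False
  then show ?thesis
    using subst_simps(6)[OF x y False] y by (auto simp: point_subst_def)
next
  case True
  have ya: "y \<in> \<L> (level a - 1)" using y True by simp
  have "is_set (level a) x" using x by (simp add: \<L>_def)
  then show ?thesis
  proof (cases rule: is_setE)
    case (1 n)
    then show ?thesis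
      using subst_simps(4)[OF x ya 1(1)] ya True by (auto simp: point_subst_def)
  next
    case (2 c X)
    have "(a, y) \<in> p\<lbrakk>x \<cdot> a\<rbrakk> \<longleftrightarrow>
        (\<exists>a' X. x = Comp a' X \<and> a' \<sharp> y \<and> p \<Turnstile> X\<lbrakk>a' \<mapsto> y\<lbrakk>a \<mapsto> x\<rbrakk>\<rbrakk>)"
      using 2(1) ya by (auto simp: point_subst_def)
    \<comment> \<open>The validity condition is thus the same for every representation of
      \<open>x\<close> whose bound atom is fresh for \<open>y\<close>.\<close>
    also have "\<dots> \<longleftrightarrow> (\<exists>a' X. x = Comp a' X \<and> a' \<sharp> y \<and> p \<Turnstile> (Elem y a)\<lbrakk>a \<mapsto> x\<rbrakk>)"
      using subst_simps(5)[OF x ya] by metis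
    also have "\<dots> \<longleftrightarrow> p \<Turnstile> (Elem y a)\<lbrakk>a \<mapsto> x\<rbrakk>"
      using Comp_fresh_rep[OF finite_free[of y], of c X] 2(1) unfolding fresh_def by metis
    finally show ?thesis using True by simp
  qed
qed

text \<open>The induction is on \<open>rank\<close> because the \<open>Forall\<close> case needs the
  hypothesis for the swapped bodies \<open>swap c b Y\<close>, which have the rank of
  \<open>Y\<close> but are in general different from it.\<close>

lemma sat_subst_iff:
  fixes a :: "'a::atom"
  assumes x: "x \<in> \<L> (level a)" and "is_pred X"
  shows "p \<Turnstile> X\<lbrakk>a \<mapsto> x\<rbrakk> \<longleftrightarrow> p\<lbrakk>x \<cdot> a\<rbrakk> \<Turnstile> X"
  using assms(2)
proof (induction "rank X" arbitrary: X rule: less_induct)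
  case less
  show ?case
  proof (cases X rule: expr_exhaust)
    case (Conj F)
    then show ?thesis
      using less by (auto simp: subst_simps(1)[OF x] rank_Conj)
  next
    case (Neg Y)
    then show ?thesis using less by (simp add: subst_simps(2)[OF x])
  next
    case (Forall b0 Y0)
    obtain b Y where bY: "Forall b0 Y0 = Forall b Y" "b \<notin> insert a (free x)" "rank Y = rank Y0"
      by (rule Forall_fresh_rep[of "insert a (free x)"]) auto
    have X: "X = Forall b Y" using Forall bY by simp
    have Y: "is_pred Y" using less.prems X by simp
    have b: "b \<sharp> x" "b \<noteq> a" using bY(2) by (auto simp: fresh_def)
    have "p \<Turnstile> X\<lbrakk>a \<mapsto> x\<rbrakk> \<longleftrightarrow> New (level b) (\<lambda>c. p \<Turnstile> swap c b (Y\<lbrakk>a \<mapsto> x\<rbrakk>))"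
      by (simp add: X subst_simps(3)[OF x Y b])
    also have "\<dots> \<longleftrightarrow> New (level b) (\<lambda>c. p\<lbrakk>x \<cdot> a\<rbrakk> \<Turnstile> swap c b Y)"
    \<comment> \<open>For \<open>c\<close> and \<open>b\<close> both different from \<open>a\<close>
      and fresh for \<open>x\<close>, the swapping fixes \<open>a\<close> and \<open>x\<close>, so
      it commutes with the substitution.\<close>
    proof (rule New_cong)
      fix c assume c: "level c = level b" "c \<notin> insert a (free x)"
      then have "swap c b (Y\<lbrakk>a \<mapsto> x\<rbrakk>) = (swap c b Y)\<lbrakk>a \<mapsto> x\<rbrakk>"
        using b Y x by (intro subst_swap_fresh) (auto simp: fresh_def)
      then show "p \<Turnstile> swap c b (Y\<lbrakk>a \<mapsto> x\<rbrakk>) \<longleftrightarrow> p\<lbrakk>x \<cdot> a\<rbrakk> \<Turnstile> swap c b Y"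
        using less.hyps[of "swap c b Y"] X Y by simp
    qed simp
    also have "\<dots> \<longleftrightarrow> p\<lbrakk>x \<cdot> a\<rbrakk> \<Turnstile> X" by (simp add: X)
    finally show ?thesis .
  next
    case (Elem y b)
    then have "y \<in> \<L> (level b - 1)" using less.prems by (simp add: \<L>_def)
    then show ?thesis using point_subst_iff[OF x] Elem by simp
  qed (use less.prems in auto)
qed

theorem theorem5p17:
  fixes p :: "('a::atom \<times> 'a expr) set"
    and X x :: "'a expr"
    and a :: 'a
    and i :: int
  assumes "prepoint p"
    and "is_pred X"
    and "a \<in> \<A> i"
    and "x \<in> \<L> i"
  shows "p \<Turnstile> X\<lbrakk>a \<mapsto> x\<rbrakk> \<longleftrightarrow> p\<lbrakk>x \<cdot> a\<rbrakk> \<Turnstile> X"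
  using sat_subst_iff[of x a X p] assms(2-4) by (simp add: \<A>_def)

end
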